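(* Let $I \subseteq \mathbb{R}$ be an interval with interior $I^{\circ}$, and let $f: I \to \mathbb{R}$ be a four times differentiable mapping on $I^{\circ}$ such that $f^{(iv)} \in L[a,b]$, where $a,b \in I$ with $a<b$. If $|f^{(iv)}|^{\frac{p}{p-1}}$ is quasi-convex on $[a,b]$ and $p>1$, then $$\left| \frac{f(a)+f(b)}{2} - \frac{1}{b-a}\int_a^b f(x)\,dx - \frac{b-a}{12}\,[f'(b)-f'(a)] \right| \le \frac{(b-a)^4}{24}\,\beta^{\frac1p}(2p+1,2p+1)\left(\max\{|f^{(iv)}(a)|^q,|f^{(iv)}(b)|^q\}\right)^{\frac1q},$$ where $q=\frac{p}{p-1}$.
   Context: A function $g:[a,b]\to\mathbb{R}$ is called quasi-convex on $[a,b]$ if $g(\lambda x+(1-\lambda)y)\le \max\{g(x),g(y)\}$ for all $x,y\in[a,b]$ and all $\lambda\in[0,1]$. $f^{(iv)}$ denotes the fourth derivative of $f$, and $L[a,b]$ denotes the set of Lebesgue integrable functions on $[a,b]$. $\beta$ is the Euler Beta function, $\beta(s,t)=\int_0^1\lambda^{s-1}(1-\lambda)^{t-1}\,d\lambda$ for $s,t>0$, and $\beta^{\frac1p}(s,t)$ means $(\beta(s,t))^{\frac1p}$; in particular $\beta(2p+1,2p+1)=\int_0^1(\lambda(1-\lambda))^{2p}\,d\lambda$. *)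

theory Defs
  imports "HOL-Analysis.Analysis"
begin

text \<open>
  The \<open>k\<close>-th derivative of \<open>f\<close> as a function on the interval \<open>I\<close>. At interior points of \<open>I\<close>
  this is the ordinary iterated derivative (see \<open>nth_deriv_interior\<close>); at an endpoint of \<open>I\<close>
  belonging to \<open>I\<close> it is the one-sided derivative. Only the values of \<open>f\<close> on \<open>I\<close> matter.
\<close>
definition nth_deriv :: "real set \<Rightarrow> nat \<Rightarrow> (real \<Rightarrow> real) \<Rightarrow> real \<Rightarrow> real" where
  "nth_deriv I k f = ((\<lambda>g x. vector_derivative g (at x within I)) ^^ k) f"

text \<open>
  \<open>S\<close> is meant to be relatively open in \<open>I\<close>, so that the derivatives of order below \<open>n\<close>
  exist in a whole \<open>I\<close>-neighbourhood of each point of \<open>S\<close>.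
\<close>
definition times_differentiable_on :: "nat \<Rightarrow> (real \<Rightarrow> real) \<Rightarrow> real set \<Rightarrow> real set \<Rightarrow> bool" where
  "times_differentiable_on n f I S \<longleftrightarrow>
     (\<forall>k<n. \<forall>x\<in>S. nth_deriv I k f differentiable (at x within I))"

definition quasi_convex_on :: "real set \<Rightarrow> (real \<Rightarrow> real) \<Rightarrow> bool" where
  "quasi_convex_on S g \<longleftrightarrow>
     (\<forall>x\<in>S. \<forall>y\<in>S. \<forall>t\<in>{0..1}. g (t * x + (1 - t) * y) \<le> max (g x) (g y))"

lemma nth_deriv_interior:
  assumes "x \<in> interior I"
  shows "nth_deriv I k f x = (deriv ^^ k) f x"
  using assms
proof (induction k arbitrary: x)
  case 0
  then show ?case by (simp add: nth_deriv_def)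
next
  case (Suc k)
  have ev: "\<forall>\<^sub>F y in nhds x. y \<in> UNIV \<longrightarrow> nth_deriv I k f y = (deriv ^^ k) f y"
    unfolding eventually_nhds
    by (rule exI[of _ "interior I"]) (simp add: Suc.IH Suc.prems)
  have "nth_deriv I (Suc k) f x = vector_derivative (nth_deriv I k f) (at x)"
    unfolding nth_deriv_def funpow.simps o_apply at_within_interior[OF Suc.prems] ..
  also have "\<dots> = vector_derivative ((deriv ^^ k) f) (at x)"
    by (rule vector_derivative_cong_eq[OF ev refl refl UNIV_I])
  also have "\<dots> = deriv ((deriv ^^ k) f) x"
    unfolding vector_derivative_def deriv_def has_real_derivative_iff_has_vector_derivative ..
  finally show ?case by simp
qed

text \<open>The library's \<open>Beta\<close> is defined through \<open>Gamma\<close>; it agrees with Euler's integral.\<close>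
lemma Beta_eq_integral:
  assumes "s > 0" "t > (0::real)"
  shows "Beta s t = integral {0..1} (\<lambda>x. x powr (s - 1) * (1 - x) powr (t - 1))"
  using has_integral_Beta_real[OF assms] by (simp add: integral_unique)

end

theory Submission
  imports Defs
begin

text \<open>
  Integrating by parts four times against the kernel \<open>(x - a)\<^sup>2 * (b - x)\<^sup>2\<close>, which vanishes to
  second order at both endpoints, turns the error into
  \<open>- 1 / (24 * (b - a)) * \<integral> (x - a)\<^sup>2 * (b - x)\<^sup>2 * f\<^sup>(\<^sup>4\<^sup>) x dx\<close>. Quasi-convexity bounds \<open>\<bar>f\<^sup>(\<^sup>4\<^sup>)\<bar>\<close> on
  \<open>[a, b]\<close> by its larger endpoint value, so the error is at most \<open>(b - a)^4 / 24 * Beta 3 3\<close> times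
  that value, and \<open>Beta 3 3 \<le> Beta (2 * p + 1) (2 * p + 1) powr (1 / p)\<close> because the
  \<open>L\<^sup>p\<close> norm of \<open>(x * (1 - x))\<^sup>2\<close> on \<open>[0, 1]\<close> dominates its \<open>L\<^sup>1\<close> norm.
\<close>

lemma has_integral_biquadratic_kernel:
  fixes a b :: real
  assumes "a \<le> b"
  shows "((\<lambda>x. (x - a)\<^sup>2 * (b - x)\<^sup>2) has_integral (b - a) ^ 5 / 30) {a..b}"
proof -
  \<comment> \<open>Expanding \<open>b - x = (b - a) - (x - a)\<close> makes the kernel a polynomial
    in \<open>x - a\<close>, integrated termwise; at \<open>b\<close> the coefficients give 1/5 -
    1/2 + 1/3 = 1/30.\<close>
  define F where
    "F x = (x - a) ^ 5 / 5 - (b - a) * (x - a) ^ 4 / 2 + (b - a)\<^sup>2 * (x - a) ^ 3 / 3" for x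
  have "(F has_vector_derivative (x - a)\<^sup>2 * (b - x)\<^sup>2) (at x within {a..b})" for x
    unfolding has_real_derivative_iff_has_vector_derivative[symmetric] F_def
    by (rule derivative_eq_intros refl | simp)+ (simp add: field_simps power_numeral_reduce)
  from fundamental_theorem_of_calculus[OF assms this]
  show ?thesis
    by (simp add: F_def field_simps power_numeral_reduce)
qed

lemma has_integral_biquadratic_kernel_fourth_deriv:
  fixes a b :: real and f f1 f2 f3 f4 :: "real \<Rightarrow> real"
  assumes "a \<le> b"
    and d1: "\<And>x. x \<in> {a..b} \<Longrightarrow> (f has_real_derivative f1 x) (at x within {a..b})"
    and d2: "\<And>x. x \<in> {a..b} \<Longrightarrow> (f1 has_real_derivative f2 x) (at x within {a..b})"
    and d3: "\<And>x. x \<in> {a..b} \<Longrightarrow> (f2 has_real_derivative f3 x) (at x within {a..b})"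
    and d4: "\<And>x. x \<in> {a..b} \<Longrightarrow> (f3 has_real_derivative f4 x) (at x within {a..b})"
  shows "((\<lambda>x. (x - a)\<^sup>2 * (b - x)\<^sup>2 * f4 x) has_integral
          24 * integral {a..b} f - 12 * (b - a) * (f a + f b) + 2 * (b - a)\<^sup>2 * (f1 b - f1 a)) {a..b}"
proof -
  define P where "P x = (x - a)\<^sup>2 * (b - x)\<^sup>2" for x
  define P1 where "P1 x = 2 * (x - a) * (b - x)\<^sup>2 - 2 * (x - a)\<^sup>2 * (b - x)" for x
  define P2 where "P2 x = 2 * (b - x)\<^sup>2 - 8 * (x - a) * (b - x) + 2 * (x - a)\<^sup>2" for x
  define P3 where "P3 x = 12 * (x - a) - 12 * (b - x)" for x
  have P: "(P has_real_derivative P1 x) (at x within S)" for x S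
    unfolding P_def P1_def
    by (rule derivative_eq_intros refl | simp)+ (simp add: algebra_simps power2_eq_square)
  have P1: "(P1 has_real_derivative P2 x) (at x within S)" for x S
    unfolding P1_def P2_def
    by (rule derivative_eq_intros refl | simp)+ (simp add: algebra_simps power2_eq_square)
  have P2: "(P2 has_real_derivative P3 x) (at x within S)" for x S
    unfolding P2_def P3_def
    by (rule derivative_eq_intros refl | simp)+
  have P3: "(P3 has_real_derivative 24) (at x within S)" for x S
    unfolding P3_def by (rule derivative_eq_intros refl | simp)+
  \<comment> \<open>All four integrations by parts at once: with alternating signs the mixed
    products cancel in the derivative, leaving \<open>P x * f4 x\<close> and the constant fourth
    derivative 24 of \<open>P\<close> times \<open>f x\<close>.\<close>
  define F where "F x = P x * f3 x - P1 x * f2 x + P2 x * f1 x - P3 x * f x" for x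
  have "(F has_vector_derivative P x * f4 x - 24 * f x) (at x within {a..b})"
    if "x \<in> {a..b}" for x
    unfolding has_real_derivative_iff_has_vector_derivative[symmetric] F_def
    by (rule derivative_eq_intros P P1 P2 P3 d1 d2 d3 d4 that refl)+ (simp add: algebra_simps)
  from fundamental_theorem_of_calculus[OF assms(1) this]
  have FTC: "((\<lambda>x. P x * f4 x - 24 * f x) has_integral F b - F a) {a..b}" .
  have "continuous_on {a..b} f"
    using d1 by (rule DERIV_continuous_on)
  then have "(f has_integral integral {a..b} f) {a..b}"
    by (simp add: integrable_continuous_real integrable_integral)
  from has_integral_add[OF FTC has_integral_mult_right[OF this, of 24]]
  have "((\<lambda>x. P x * f4 x) has_integral F b - F a + 24 * integral {a..b} f) {a..b}"
    by simp
  \<comment> \<open>\<open>P\<close> and \<open>P1\<close> vanish at both endpoints, which removes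
    \<open>f3\<close> and \<open>f2\<close>. \<open>P2\<close> equals
    \<open>2 * (b - a)\<^sup>2\<close> at both, while \<open>P3\<close> is
    \<open>12 * (b - a)\<close> at \<open>b\<close> and its negative at \<open>a\<close>, hence the
    sum \<open>f a + f b\<close>.\<close>
  moreover have "F b - F a = 2 * (b - a)\<^sup>2 * (f1 b - f1 a) - 12 * (b - a) * (f a + f b)"
    by (simp add: F_def P_def P1_def P2_def P3_def algebra_simps power2_eq_square)
  ultimately show ?thesis
    by (simp add: P_def algebra_simps)
qed

lemma corrected_trapezoid_error_bound:
  fixes a b M :: real and f f1 f2 f3 f4 :: "real \<Rightarrow> real"
  assumes "a < b"
    and d1: "\<And>x. x \<in> {a..b} \<Longrightarrow> (f has_real_derivative f1 x) (at x within {a..b})"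
    and d2: "\<And>x. x \<in> {a..b} \<Longrightarrow> (f1 has_real_derivative f2 x) (at x within {a..b})"
    and d3: "\<And>x. x \<in> {a..b} \<Longrightarrow> (f2 has_real_derivative f3 x) (at x within {a..b})"
    and d4: "\<And>x. x \<in> {a..b} \<Longrightarrow> (f3 has_real_derivative f4 x) (at x within {a..b})"
    and M: "\<And>x. x \<in> {a..b} \<Longrightarrow> \<bar>f4 x\<bar> \<le> M"
  shows "\<bar>(f a + f b) / 2 - 1 / (b - a) * integral {a..b} f - (b - a) / 12 * (f1 b - f1 a)\<bar>
         \<le> (b - a) ^ 4 / 720 * M"
proof -
  let ?P = "\<lambda>x. (x - a)\<^sup>2 * (b - x)\<^sup>2"
  let ?E = "(f a + f b) / 2 - 1 / (b - a) * integral {a..b} f - (b - a) / 12 * (f1 b - f1 a)"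
  have "((\<lambda>x. ?P x * f4 x) has_integral
          24 * integral {a..b} f - 12 * (b - a) * (f a + f b) + 2 * (b - a)\<^sup>2 * (f1 b - f1 a)) {a..b}"
    using assms by (intro has_integral_biquadratic_kernel_fourth_deriv) auto
  moreover have "24 * integral {a..b} f - 12 * (b - a) * (f a + f b) + 2 * (b - a)\<^sup>2 * (f1 b - f1 a)
      = - 24 * (b - a) * ?E"
    using \<open>a < b\<close> by (simp add: field_simps power2_eq_square)
  ultimately have 1: "((\<lambda>x. ?P x * f4 x) has_integral - 24 * (b - a) * ?E) {a..b}"
    by simp
  have 2: "((\<lambda>x. ?P x * M) has_integral (b - a) ^ 5 / 30 * M) {a..b}"
    using \<open>a < b\<close> by (intro has_integral_mult_left has_integral_biquadratic_kernel) simp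
  \<comment> \<open>Dividing by \<open>24 * h\<close> with \<open>h = b - a\<close> lowers the power
    from 5 to 4 and gives 720 = 24 * 30.\<close>
  have rescale: "\<bar>e\<bar> \<le> h ^ 4 / 720 * M"
    if "\<bar>- 24 * h * e\<bar> \<le> h ^ 5 / 30 * M" "h > 0" for h e :: real
  proof -
    have "24 * h * \<bar>e\<bar> \<le> 24 * h * (h ^ 4 / 720 * M)"
      using that by (simp add: abs_mult eval_nat_numeral mult_ac)
    then show ?thesis
      using \<open>h > 0\<close> by (subst (asm) mult_le_cancel_left_pos) auto
  qed
  have "norm (integral {a..b} (\<lambda>x. ?P x * f4 x)) \<le> integral {a..b} (\<lambda>x. ?P x * M)"
    using 1 2 M
    by (intro integral_norm_bound_integral)
       (auto simp: abs_mult intro!: mult_left_mono has_integral_integrable)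
  then have "\<bar>- 24 * (b - a) * ?E\<bar> \<le> (b - a) ^ 5 / 30 * M"
    unfolding integral_unique[OF 1] integral_unique[OF 2] by simp
  then show ?thesis
    by (rule rescale) (simp add: \<open>a < b\<close>)
qed

text \<open>A convex function lies above its tangent at \<open>c\<close>. Convexity is invoked on
  the open half-line, so \<open>u = 0\<close> is treated separately: there the tangent has the value
  \<open>(1 - p) * c powr p\<close>, which is at most 0.\<close>

lemma powr_ge_tangent:
  fixes u c p :: real
  assumes "u \<ge> 0" "c > 0" "p \<ge> 1"
  shows "c powr p + p * c powr (p - 1) * (u - c) \<le> u powr p"
proof (cases "u = 0")
  case True
  have "c powr p = c powr (p - 1) * c"
    using \<open>c > 0\<close> by (simp add: powr_diff)
  then have "c powr p + p * c powr (p - 1) * (u - c) = (1 - p) * c powr p"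
    using True by (simp add: algebra_simps)
  also have "\<dots> \<le> 0"
    using \<open>p \<ge> 1\<close> by (simp add: mult_nonpos_nonneg)
  finally show ?thesis
    using True by simp
next
  case False
  have "((\<lambda>x. x powr p) has_real_derivative p * c powr (p - 1)) (at c within {0<..})"
    using \<open>c > 0\<close> by (intro DERIV_subset[OF has_real_derivative_powr]) auto
  then have "u powr p - c powr p \<ge> p * c powr (p - 1) * (u - c)"
    using assms False
    by (intro convex_on_imp_above_tangent[OF powr_convex]) (auto simp: interior_open)
  then show ?thesis by simp
qed

text \<open>Jensen's inequality for \<open>x powr p\<close> on the unit interval, obtained by
  integrating the tangent bound and taking \<open>p\<close>-th roots.\<close>

lemma Beta_powr_inverse_ge:
  fixes p :: real
  assumes "p \<ge> 1"
  shows "1 / 30 \<le> Beta (2 * p + 1) (2 * p + 1) powr (1 / p)"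
proof -
  \<comment> \<open>The mean of \<open>?u\<close> over the unit interval; with the tangent taken
    there, the linear term integrates to 0.\<close>
  define c :: real where "c = 1 / 30"
  let ?u = "\<lambda>x::real. x\<^sup>2 * (1 - x)\<^sup>2"
  have u: "(?u has_integral c) {0..1}"
    using has_integral_biquadratic_kernel[of 0 1] by (simp add: c_def)
  have "((\<lambda>x. c powr p + p * c powr (p - 1) * (?u x - c)) has_integral
      c powr p + p * c powr (p - 1) * (c - c)) {0..1}"
    using has_integral_const_real[of "c powr p" 0 1] has_integral_const_real[of c 0 1]
    by (intro has_integral_add has_integral_mult_right has_integral_diff u) simp_all
  moreover have "((\<lambda>x. x powr (2 * p) * (1 - x) powr (2 * p)) has_integral
      Beta (2 * p + 1) (2 * p + 1)) {0..1}"
    using has_integral_Beta_real[of "2 * p + 1" "2 * p + 1"] assms by simp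
  moreover have "c powr p + p * c powr (p - 1) * (?u x - c) \<le> x powr (2 * p) * (1 - x) powr (2 * p)"
    if "x \<in> {0..1}" for x
  proof -
    have "?u x powr p = x powr (2 * p) * (1 - x) powr (2 * p)"
      using that by (simp add: powr_mult powr_powr flip: powr_numeral)
    moreover have "c powr p + p * c powr (p - 1) * (?u x - c) \<le> ?u x powr p"
      using assms by (intro powr_ge_tangent) (auto simp: c_def)
    ultimately show ?thesis by simp
  qed
  ultimately have "c powr p + p * c powr (p - 1) * (c - c) \<le> Beta (2 * p + 1) (2 * p + 1)"
    by (rule has_integral_le)
  then have "(c powr p) powr (1 / p) \<le> Beta (2 * p + 1) (2 * p + 1) powr (1 / p)"
    using assms by (intro powr_mono2) auto
  then show ?thesis
    using assms by (simp add: powr_powr c_def)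
qed

lemma nth_deriv_has_derivative_within:
  assumes "times_differentiable_on n f I S" "k < n" "x \<in> S" "T \<subseteq> I"
  shows "(nth_deriv I k f has_real_derivative nth_deriv I (Suc k) f x) (at x within T)"
proof -
  have "nth_deriv I k f differentiable (at x within I)"
    using assms unfolding times_differentiable_on_def by blast
  then have "(nth_deriv I k f has_vector_derivative nth_deriv I (Suc k) f x) (at x within I)"
    unfolding nth_deriv_def by (simp add: vector_derivative_works)
  then show ?thesis
    using assms(4) by (auto simp: has_real_derivative_iff_has_vector_derivative
        intro: has_vector_derivative_within_subset)
qed

lemma quasi_convex_on_le_max:
  assumes "quasi_convex_on {a..b} g" "x \<in> {a..b}"
  shows "g x \<le> max (g a) (g b)"
proof -
  have "x \<in> closed_segment a b"
    using assms(2) by (auto simp: closed_segment_eq_real_ivl)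
  then obtain t where "0 \<le> t" "t \<le> 1" "x = (1 - t) * a + t * b"
    by (auto simp: closed_segment_def)
  moreover have "a \<in> {a..b}" "b \<in> {a..b}" "1 - t \<in> {0..1}"
    using assms(2) calculation by auto
  \<comment> \<open>\<open>closed_segment\<close> puts the weight \<open>1 - t\<close> on
    \<open>a\<close>, so \<open>quasi_convex_on\<close> is instantiated with
    \<open>1 - t\<close>.\<close>
  then have "g ((1 - t) * a + (1 - (1 - t)) * b) \<le> max (g a) (g b)"
    using assms(1) unfolding quasi_convex_on_def by blast
  ultimately show ?thesis
    by simp
qed

theorem theorem2p3:
  fixes I :: "real set" and f :: "real \<Rightarrow> real" and a b p q :: real
  assumes "is_interval I"
    and "a \<in> I" and "b \<in> I" and "a < b"
    and "times_differentiable_on 4 f I (interior I \<union> {a, b})"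
    and "set_integrable lebesgue {a..b} (nth_deriv I 4 f)"
    and "p > 1" and "q = p / (p - 1)"
    and "quasi_convex_on {a..b} (\<lambda>x. \<bar>nth_deriv I 4 f x\<bar> powr (p / (p - 1)))"
  shows "\<bar>(f a + f b) / 2 - 1 / (b - a) * integral {a..b} f
            - (b - a) / 12 * (nth_deriv I 1 f b - nth_deriv I 1 f a)\<bar>
         \<le> (b - a) ^ 4 / 24 * Beta (2 * p + 1) (2 * p + 1) powr (1 / p)
            * (max (\<bar>nth_deriv I 4 f a\<bar> powr q) (\<bar>nth_deriv I 4 f b\<bar> powr q)) powr (1 / q)"
proof -
  define M where "M = (max (\<bar>nth_deriv I 4 f a\<bar> powr q) (\<bar>nth_deriv I 4 f b\<bar> powr q)) powr (1 / q)"
  have "q > 0"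
    using assms by simp
  have sub: "{a..b} \<subseteq> I"
    using assms mem_is_interval_1_I by (metis atLeastAtMost_iff subsetI)
  \<comment> \<open>\<open>a\<close> and \<open>b\<close> may be endpoints of \<open>I\<close>, with
    one-sided derivatives; derivatives within \<open>{a..b}\<close> treat them like interior
    points.\<close>
  have "{a<..<b} \<subseteq> interior I"
    using sub by (intro interior_maximal) auto
  then have "{a..b} \<subseteq> interior I \<union> {a, b}"
    by force
  then have d: "(nth_deriv I k f has_real_derivative nth_deriv I (Suc k) f x) (at x within {a..b})"
    if "k < 4" "x \<in> {a..b}" for k x
    using that sub by (intro nth_deriv_has_derivative_within[OF assms(5)]) auto
  \<comment> \<open>Quasi-convexity bounds the \<open>q\<close>-th power; taking \<open>q\<close>-th
    roots preserves the order.\<close>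
  have M: "\<bar>nth_deriv I 4 f x\<bar> \<le> M" if "x \<in> {a..b}" for x
  proof -
    have "(\<bar>nth_deriv I 4 f x\<bar> powr q) powr (1 / q) \<le> M"
      unfolding M_def using quasi_convex_on_le_max[OF assms(9) that] \<open>q > 0\<close>
      unfolding assms(8)[symmetric] by (intro powr_mono2) auto
    then show ?thesis
      using \<open>q > 0\<close> by (simp add: powr_powr)
  qed
  have "f = nth_deriv I 0 f"
    by (simp add: nth_deriv_def)
  then have "\<bar>(f a + f b) / 2 - 1 / (b - a) * integral {a..b} f
      - (b - a) / 12 * (nth_deriv I 1 f b - nth_deriv I 1 f a)\<bar> \<le> (b - a) ^ 4 / 720 * M"
    using d[of 0] d[of 1] d[of 2] d[of 3] M assms(4)
    by (intro corrected_trapezoid_error_bound[where ?f2.0 = "nth_deriv I 2 f"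
          and ?f3.0 = "nth_deriv I 3 f" and ?f4.0 = "nth_deriv I 4 f"])
       (simp_all add: eval_nat_numeral)
  \<comment> \<open>The factor 1/30 is split off as the value of \<open>Beta 3 3\<close>, the case
    \<open>p = 1\<close> of the Beta factor.\<close>
  also have "\<dots> = (b - a) ^ 4 / 24 * (1 / 30) * M"
    by simp
  also have "\<dots> \<le> (b - a) ^ 4 / 24 * Beta (2 * p + 1) (2 * p + 1) powr (1 / p) * M"
    using assms(7) by (intro mult_right_mono mult_left_mono Beta_powr_inverse_ge) (auto simp: M_def)
  finally show ?thesis
    unfolding M_def .
qed

end
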